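(* Let $m,n,k \geq 2$. The poset $m\oplus n \oplus k$ is 2-S\l upecki if and only if $n>B(m,k)+1$.
   Context: Posets are viewed as reflexive digraphs with arc relation $\leq$. For $n\geq1$, $n$ also denotes the $n$-element antichain; the ordinal sum $\mathbb{P}\oplus\mathbb{Q}$ is the disjoint union with additionally $p\leq q$ for all $p\in P$, $q\in Q$. A binary polymorphism is a monotone map $\mathbb{P}^2\to\mathbb{P}$; it is essentially unary if it equals $(x_1,x_2)\mapsto g(x_i)$ for some $i$ and monotone $g:\mathbb{P}\to\mathbb{P}$. $\mathbb{P}$ is 2-S\l upecki if all its surjective binary polymorphisms are essentially unary. For integers $m,k\geq2$, $\mu(m,k)$ is the maximum of $\alpha\gamma+\beta\delta$ over integers $\alpha,\beta,\gamma,\delta$ with $0<\alpha,\beta<m$, $0<\gamma,\delta<k$, $(m-\alpha)(m-\beta)\geq m-1$ and $(k-\gamma)(k-\delta)\geq k-1$, and $B(m,k)=\max(\mu(m,k),mk)$ (with the convention that the maximum is $mk$ if no such integers exist). *)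

theory Defs
  imports Main "HOL-Library.FuncSet"
begin

text \<open>A poset is given by its reflexive order relation \<open>r\<close>; its underlying set is \<^term>\<open>Field r\<close>.\<close>

definition antichain :: "nat \<Rightarrow> nat rel" where
  "antichain n = Id_on {..<n}"

definition ordinal_sum :: "'a rel \<Rightarrow> 'b rel \<Rightarrow> ('a + 'b) rel" (infixl "\<oplus>" 65) where
  "r \<oplus> s = {(Inl x, Inl y) | x y. (x, y) \<in> r}
         \<union> {(Inr x, Inr y) | x y. (x, y) \<in> s}
         \<union> {(Inl x, Inr y) | x y. x \<in> Field r \<and> y \<in> Field s}"

definition product_order :: "'a rel \<Rightarrow> 'b rel \<Rightarrow> ('a \<times> 'b) rel" where
  "product_order r s = {((x, y), (x', y')) | x y x' y'. (x, x') \<in> r \<and> (y, y') \<in> s}"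

definition monotone_map :: "'a rel \<Rightarrow> 'b rel \<Rightarrow> ('a \<Rightarrow> 'b) \<Rightarrow> bool" where
  "monotone_map r s f \<longleftrightarrow>
     f \<in> Field r \<rightarrow> Field s \<and>
     monotone_on (Field r) (\<lambda>x y. (x, y) \<in> r) (\<lambda>x y. (x, y) \<in> s) f"

definition binary_polymorphism :: "'a rel \<Rightarrow> ('a \<times> 'a \<Rightarrow> 'a) \<Rightarrow> bool" where
  "binary_polymorphism r f \<longleftrightarrow> monotone_map (product_order r r) r f"

definition essentially_unary :: "'a rel \<Rightarrow> ('a \<times> 'a \<Rightarrow> 'a) \<Rightarrow> bool" where
  "essentially_unary r f \<longleftrightarrow>
     (\<exists>g. monotone_map r r g \<and>
        ((\<forall>x1 \<in> Field r. \<forall>x2 \<in> Field r. f (x1, x2) = g x1) \<or>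
         (\<forall>x1 \<in> Field r. \<forall>x2 \<in> Field r. f (x1, x2) = g x2)))"

definition two_slupecki :: "'a rel \<Rightarrow> bool" where
  "two_slupecki r \<longleftrightarrow>
     (\<forall>f. binary_polymorphism r f \<and> f ` (Field r \<times> Field r) = Field r
        \<longrightarrow> essentially_unary r f)"

text \<open>For \<open>m, k \<ge> 2\<close> none of the subtractions below is truncated.\<close>

definition mu_values :: "nat \<Rightarrow> nat \<Rightarrow> nat set" where
  "mu_values m k =
     {\<alpha> * \<gamma> + \<beta> * \<delta> | \<alpha> \<beta> \<gamma> \<delta>.
        0 < \<alpha> \<and> \<alpha> < m \<and> 0 < \<beta> \<and> \<beta> < m \<and>
        0 < \<gamma> \<and> \<gamma> < k \<and> 0 < \<delta> \<and> \<delta> < k \<and>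
        (m - \<alpha>) * (m - \<beta>) \<ge> m - 1 \<and>
        (k - \<gamma>) * (k - \<delta>) \<ge> k - 1}"

definition mu :: "nat \<Rightarrow> nat \<Rightarrow> nat" where
  "mu m k = Max (mu_values m k)"

definition B_bound :: "nat \<Rightarrow> nat \<Rightarrow> nat" where
  "B_bound m k = (if mu_values m k = {} then m * k else max (mu m k) (m * k))"

lemma finite_mu_values: "finite (mu_values m k)"
proof (rule finite_subset)
  show "mu_values m k \<subseteq> {..m * k + m * k}"
    by (auto simp: mu_values_def intro!: add_mono mult_mono)
qed simp

lemma Field_iff: "x \<in> Field r \<longleftrightarrow> (\<exists>y. (x, y) \<in> r \<or> (y, x) \<in> r)"
  by (auto simp: Field_def)

lemma Field_antichain: "Field (antichain n) = {..<n}"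
  by (auto simp: antichain_def Field_def)

lemma Partial_order_antichain: "Partial_order (antichain n)"
  unfolding Field_antichain
  by (auto simp: antichain_def partial_order_on_def preorder_on_def refl_on_def
      trans_def antisym_def)

lemma Field_ordinal_sum: "Field (r \<oplus> s) = Field r <+> Field s"
proof (rule set_eqI)
  fix z show "z \<in> Field (r \<oplus> s) \<longleftrightarrow> z \<in> Field r <+> Field s"
    by (cases z) (auto simp: ordinal_sum_def Field_iff)
qed

lemma Partial_order_ordinal_sum:
  assumes "Partial_order r" and "Partial_order s"
  shows "Partial_order (r \<oplus> s)"
proof -
  have F: "x \<in> Field r \<and> y \<in> Field r" if "(x, y) \<in> r" for x y
    using that by (auto simp: Field_def)
  have G: "x \<in> Field s \<and> y \<in> Field s" if "(x, y) \<in> s" for x y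
    using that by (auto simp: Field_def)
  have "refl_on (Field (r \<oplus> s)) (r \<oplus> s)"
    using assms unfolding Field_ordinal_sum
    by (auto simp: ordinal_sum_def partial_order_on_def preorder_on_def refl_on_def)
  moreover have "r \<oplus> s \<subseteq> Field (r \<oplus> s) \<times> Field (r \<oplus> s)"
    by (auto simp: Field_def)
  moreover have "trans (r \<oplus> s)"
  proof (rule transI)
    fix x y z assume "(x, y) \<in> r \<oplus> s" "(y, z) \<in> r \<oplus> s"
    then show "(x, z) \<in> r \<oplus> s"
      using assms F G
      by (auto simp: ordinal_sum_def partial_order_on_def preorder_on_def dest: transD)
  qed
  moreover have "antisym (r \<oplus> s)"
    using assms by (auto simp: ordinal_sum_def partial_order_on_def antisym_def)
  ultimately show ?thesis
    by (simp add: partial_order_on_def preorder_on_def)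
qed

lemma Field_product_order:
  assumes "Partial_order r" and "Partial_order s"
  shows "Field (product_order r s) = Field r \<times> Field s"
proof
  show "Field (product_order r s) \<subseteq> Field r \<times> Field s"
    by (auto simp: product_order_def Field_def)
  show "Field r \<times> Field s \<subseteq> Field (product_order r s)"
  proof
    fix p assume "p \<in> Field r \<times> Field s"
    then have "(p, p) \<in> product_order r s"
      using assms
      by (auto simp: product_order_def partial_order_on_def preorder_on_def refl_on_def)
    then show "p \<in> Field (product_order r s)"
      by (auto simp: Field_def)
  qed
qed

end

theory Submission
  imports Defs
begin

text \<open>
  Let \<open>M\<close>, \<open>N\<close>, \<open>K\<close> be the three layers. A monotone \<open>f\<close> is constant on the connected components of
  the preimage of each layer, so the question is how many components these preimages can have.
  Surjectivity onto \<open>M\<close> and \<open>K\<close> forces \<open>N \<times> N\<close> into the preimage of \<open>N\<close>. If \<open>f\<close> is not constant on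
  \<open>N \<times> N\<close>, this propagates to all nine blocks and \<open>f\<close> depends on one argument only. If \<open>f\<close> is
  constant there, every other value in \<open>N\<close> is attained at an isolated pair of \<open>M \<times> K\<close> or \<open>K \<times> M\<close>;
  these pairs form two rectangles of sizes \<open>\<alpha> \<gamma>\<close> and \<open>\<beta> \<delta>\<close>, where \<open>\<alpha>\<close> and \<open>\<beta>\<close> count the elements of
  \<open>M\<close> whose row resp. column over \<open>N\<close> is sent to \<open>M\<close>. When both are positive, all these rows and
  columns carry a single value, which is the inequality \<open>(m - \<alpha>) (m - \<beta>) \<ge> m - 1\<close>; dually for \<open>K\<close>.
  Conversely, such a configuration defines a polymorphism block by block.
\<close>

section \<open>Posets with three antichain layers\<close>

text \<open>The layers are subsets of one type instead of summands of a nested sum type, so the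
  order dual is obtained by exchanging \<open>M\<close> and \<open>K\<close>.\<close>

definition layered :: "'a set \<Rightarrow> 'a set \<Rightarrow> 'a set \<Rightarrow> 'a rel" where
  "layered M N K = Id_on (M \<union> N \<union> K) \<union> M \<times> N \<union> M \<times> K \<union> N \<times> K"

lemma Field_layered: "Field (layered M N K) = M \<union> N \<union> K"
  by (auto simp: layered_def Field_def Id_on_def)

lemma layered_refl: "x \<in> M \<union> N \<union> K \<Longrightarrow> (x, x) \<in> layered M N K"
  by (auto simp: layered_def)

lemma layered_less:
  "x \<in> M \<Longrightarrow> y \<in> N \<Longrightarrow> (x, y) \<in> layered M N K"
  "x \<in> M \<Longrightarrow> y \<in> K \<Longrightarrow> (x, y) \<in> layered M N K"
  "x \<in> N \<Longrightarrow> y \<in> K \<Longrightarrow> (x, y) \<in> layered M N K"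
  by (auto simp: layered_def)

lemma layered_cases:
  assumes "(x, y) \<in> layered M N K"
  obtains "x \<in> M" "y = x" | "x \<in> N" "y = x" | "x \<in> K" "y = x"
    | "x \<in> M" "y \<in> N" | "x \<in> M" "y \<in> K" | "x \<in> N" "y \<in> K"
  using assms unfolding layered_def by blast

lemma layered_converse: "layered K N M = (layered M N K)\<inverse>"
  by (auto simp: layered_def)

lemma Field_product_layered:
  "Field (product_order (layered M N K) (layered M N K)) = (M \<union> N \<union> K) \<times> (M \<union> N \<union> K)"
proof -
  have "((x, y), (x, y)) \<in> product_order (layered M N K) (layered M N K)"
    if "x \<in> M \<union> N \<union> K" "y \<in> M \<union> N \<union> K" for x y
    using that layered_refl [of _ M N K] unfolding product_order_def by blast
  then have "(M \<union> N \<union> K) \<times> (M \<union> N \<union> K) \<subseteq> Field (product_order (layered M N K) (layered M N K))"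
    by (blast intro: FieldI1)
  moreover have "Field (product_order (layered M N K) (layered M N K)) \<subseteq>
      Field (layered M N K) \<times> Field (layered M N K)"
    by (auto simp: Field_def product_order_def)
  ultimately show ?thesis
    unfolding Field_layered by blast
qed

text \<open>Related elements always lie in the carrier, so monotonicity can be stated without
  membership conditions.\<close>

lemma binary_polymorphism_layered:
  "binary_polymorphism (layered M N K) f \<longleftrightarrow>
     f \<in> (M \<union> N \<union> K) \<times> (M \<union> N \<union> K) \<rightarrow> M \<union> N \<union> K \<and>
     (\<forall>x x' y y'. (x, x') \<in> layered M N K \<longrightarrow> (y, y') \<in> layered M N K \<longrightarrow>
        (f (x, y), f (x', y')) \<in> layered M N K)"
proof -
  define P where "P = M \<union> N \<union> K"
  define r where "r = layered M N K"
  have field: "x \<in> P" "y \<in> P" if "(x, y) \<in> r" for x y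
    using that by (auto simp: layered_def P_def r_def)
  show ?thesis
    unfolding binary_polymorphism_def monotone_map_def Field_product_layered
      Field_layered monotone_on_def
    unfolding P_def [symmetric] r_def [symmetric] product_order_def
    by auto (meson field)
qed

lemma two_distinct:
  assumes "2 \<le> card S"
  shows "\<exists>x\<in>S. \<exists>y\<in>S. x \<noteq> y"
proof -
  obtain T where "T \<subseteq> S" "card T = 2"
    using obtain_subset_with_card_n [OF assms] by blast
  then show ?thesis by (auto simp: card_2_iff)
qed

section \<open>Surjective binary polymorphisms of a layered poset\<close>

text \<open>The assumptions are invariant under exchanging the two arguments of \<open>f\<close>
  (\<open>swap\<close>) and under reversing the order (\<open>dual\<close>). Facts proved for
  \<open>M\<close> or for the first argument therefore transfer by interpretation.\<close>

locale layered_surjection =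
  fixes M N K :: "'a set" and f :: "'a \<times> 'a \<Rightarrow> 'a"
  assumes disjoint: "M \<inter> N = {}" "M \<inter> K = {}" "N \<inter> K = {}"
    and finite: "finite M" "finite N" "finite K"
    and card: "2 \<le> card M" "2 \<le> card N" "2 \<le> card K"
    and polymorphism: "binary_polymorphism (layered M N K) f"
    and onto: "f ` ((M \<union> N \<union> K) \<times> (M \<union> N \<union> K)) = M \<union> N \<union> K"
begin

abbreviation le (infix "\<preceq>" 50) where
  "x \<preceq> y \<equiv> (x, y) \<in> layered M N K"

lemma mono: "x \<preceq> x' \<Longrightarrow> y \<preceq> y' \<Longrightarrow> f (x, y) \<preceq> f (x', y')"
  using polymorphism unfolding binary_polymorphism_layered by blast

lemma closed: "x \<in> M \<union> N \<union> K \<Longrightarrow> y \<in> M \<union> N \<union> K \<Longrightarrow> f (x, y) \<in> M \<union> N \<union> K"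
  using polymorphism unfolding binary_polymorphism_layered by blast

lemma le_bottom: "x \<preceq> y \<Longrightarrow> y \<in> M \<Longrightarrow> x = y"
  using disjoint by (auto simp: layered_def)

lemma le_top: "x \<preceq> y \<Longrightarrow> x \<in> K \<Longrightarrow> x = y"
  using disjoint by (auto simp: layered_def)

lemma le_middle: "x \<preceq> y \<Longrightarrow> x \<in> N \<Longrightarrow> y \<in> N \<Longrightarrow> x = y"
  using disjoint by (auto simp: layered_def)

lemma le_middle_bottom: "x \<preceq> y \<Longrightarrow> y \<in> N \<Longrightarrow> x \<noteq> y \<Longrightarrow> x \<in> M"
  using disjoint by (auto simp: layered_def)

lemma le_middle_top: "x \<preceq> y \<Longrightarrow> x \<in> N \<Longrightarrow> x \<noteq> y \<Longrightarrow> y \<in> K"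
  using disjoint by (auto simp: layered_def)

lemma swap: "layered_surjection M N K (f \<circ> prod.swap)"
proof
  show "binary_polymorphism (layered M N K) (f \<circ> prod.swap)"
    using polymorphism unfolding binary_polymorphism_layered by auto
  have "prod.swap ` ((M \<union> N \<union> K) \<times> (M \<union> N \<union> K)) = (M \<union> N \<union> K) \<times> (M \<union> N \<union> K)"
    by (rule product_swap)
  then show "(f \<circ> prod.swap) ` ((M \<union> N \<union> K) \<times> (M \<union> N \<union> K)) = M \<union> N \<union> K"
    using onto by (metis image_comp)
qed (use disjoint finite card in simp_all)

lemma dual: "layered_surjection K N M f"
proof
  have carrier: "K \<union> N \<union> M = M \<union> N \<union> K" by blast
  show "binary_polymorphism (layered K N M) f"
    using polymorphism unfolding binary_polymorphism_layered carrier
    unfolding layered_converse [of K N M] by blast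
  show "f ` ((K \<union> N \<union> M) \<times> (K \<union> N \<union> M)) = K \<union> N \<union> M"
    unfolding carrier by (rule onto)
qed (use disjoint finite card in \<open>simp_all add: Int_commute\<close>)

lemma less_simps [simp]:
  "x \<in> M \<Longrightarrow> y \<in> N \<Longrightarrow> x \<preceq> y" "x \<in> M \<Longrightarrow> y \<in> K \<Longrightarrow> x \<preceq> y" "x \<in> N \<Longrightarrow> y \<in> K \<Longrightarrow> x \<preceq> y"
  by (simp_all add: layered_less)

lemma mono_left: "x \<preceq> x' \<Longrightarrow> y \<in> M \<union> N \<union> K \<Longrightarrow> f (x, y) \<preceq> f (x', y)"
  by (rule mono [OF _ layered_refl])

lemma mono_right: "x \<in> M \<union> N \<union> K \<Longrightarrow> y \<preceq> y' \<Longrightarrow> f (x, y) \<preceq> f (x, y')"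
  by (rule mono [OF layered_refl])

lemma left_bottom: "x \<preceq> x' \<Longrightarrow> y \<in> M \<union> N \<union> K \<Longrightarrow> f (x', y) \<in> M \<Longrightarrow> f (x, y) = f (x', y)"
  by (rule le_bottom [OF mono_left])

lemma right_bottom: "x \<in> M \<union> N \<union> K \<Longrightarrow> y \<preceq> y' \<Longrightarrow> f (x, y') \<in> M \<Longrightarrow> f (x, y) = f (x, y')"
  by (rule le_bottom [OF mono_right])

lemma left_top: "x \<preceq> x' \<Longrightarrow> y \<in> M \<union> N \<union> K \<Longrightarrow> f (x, y) \<in> K \<Longrightarrow> f (x, y) = f (x', y)"
  by (rule le_top [OF mono_left])

lemma right_top: "x \<in> M \<union> N \<union> K \<Longrightarrow> y \<preceq> y' \<Longrightarrow> f (x, y) \<in> K \<Longrightarrow> f (x, y) = f (x, y')"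
  by (rule le_top [OF mono_right])

lemma right_middle:
  "x \<in> M \<union> N \<union> K \<Longrightarrow> y \<preceq> y' \<Longrightarrow> f (x, y) \<in> N \<Longrightarrow> f (x, y') \<in> N \<Longrightarrow> f (x, y) = f (x, y')"
  by (rule le_middle [OF mono_right])

text \<open>Elements of \<open>M\<close> are minimal: lowering both coordinates of a preimage of
  \<open>d\<close> into \<open>M\<close> cannot change the value.\<close>

lemma bottom_onto:
  assumes "d \<in> M"
  obtains a a' where "a \<in> M" "a' \<in> M" "f (a, a') = d"
proof -
  obtain a0 where a0: "a0 \<in> M" using assms by blast
  have below: "\<exists>a\<in>M. a \<preceq> x" if "x \<in> M \<union> N \<union> K" for x
    using that a0 by (auto simp: layered_def)
  have "d \<in> f ` ((M \<union> N \<union> K) \<times> (M \<union> N \<union> K))"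
    unfolding onto using assms by blast
  then obtain x y where xy: "x \<in> M \<union> N \<union> K" "y \<in> M \<union> N \<union> K" "f (x, y) = d"
    by blast
  obtain a a' where a: "a \<in> M" "a \<preceq> x" "a' \<in> M" "a' \<preceq> y"
    using below [OF xy(1)] below [OF xy(2)] by blast
  have "f (a, a') = d"
    using le_bottom mono [OF a(2,4)] xy(3) assms by blast
  with a that show thesis by blast
qed

lemma bottom_nonconstant: "\<exists>a\<in>M. \<exists>a'\<in>M. f (a, a') \<in> M \<and> f (a, a') \<noteq> d"
proof -
  obtain e where "e \<in> M" "e \<noteq> d"
    using two_distinct [OF card(1)] by metis
  then show ?thesis
    using bottom_onto [of e] by blast
qed

text \<open>All of \<open>M \<times> M\<close> lies below \<open>(b, b')\<close>, so a minimal value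
  there would be the only value on \<open>M \<times> M\<close>, contrary to
  \<open>bottom_nonconstant\<close>.\<close>

lemma middle_not_bottom:
  assumes "b \<in> N" "b' \<in> N"
  shows "f (b, b') \<notin> M"
proof
  assume *: "f (b, b') \<in> M"
  obtain a a' where a: "a \<in> M" "a' \<in> M" "f (a, a') \<noteq> f (b, b')"
    using bottom_nonconstant by blast
  have "f (a, a') \<preceq> f (b, b')"
    using a assms by (intro mono layered_less)
  with * a show False using le_bottom by blast
qed

lemma middle_in_middle:
  assumes "b \<in> N" "b' \<in> N"
  shows "f (b, b') \<in> N"
proof -
  have "f (b, b') \<notin> K"
    using layered_surjection.middle_not_bottom [OF dual] assms by blast
  moreover have "f (b, b') \<in> M \<union> N \<union> K"
    using closed assms by blast
  ultimately show ?thesis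
    using middle_not_bottom assms by blast
qed

section \<open>Counting when \<open>f\<close> is constant on the middle block\<close>

text \<open>Reversing the order turns \<open>first_bottom\<close> into \<open>first_top\<close> and
  \<open>second_bottom\<close> into \<open>second_top\<close>, so one cardinality bound serves both
  ends of the poset.\<close>

definition first_bottom :: "'a set" where
  "first_bottom = {a \<in> M. \<forall>b\<in>N. f (a, b) \<in> M}"

definition second_bottom :: "'a set" where
  "second_bottom = {a \<in> M. \<forall>b\<in>N. f (b, a) \<in> M}"

definition first_top :: "'a set" where
  "first_top = {c \<in> K. \<forall>b\<in>N. f (c, b) \<in> K}"

definition second_top :: "'a set" where
  "second_top = {c \<in> K. \<forall>b\<in>N. f (b, c) \<in> K}"

text \<open>Any row over \<open>first_bottom\<close> meets any column over \<open>second_bottom\<close>, so all of them carry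
  the same value and the other \<open>card M - 1\<close> values must come from the complementary rectangle.\<close>

lemma bottom_card_bound:
  assumes "first_bottom \<noteq> {}" "second_bottom \<noteq> {}"
  shows "card M - 1 \<le> (card M - card first_bottom) * (card M - card second_bottom)"
proof -
  obtain b where b: "b \<in> N" using two_distinct [OF card(2)] by blast
  have row: "f (a, a') = f (a, b)" if "a \<in> first_bottom" "a' \<in> M" for a a'
    using that b right_bottom [of a a' b] by (simp add: first_bottom_def)
  have col: "f (a, a') = f (b, a')" if "a' \<in> second_bottom" "a \<in> M" for a a'
    using that b left_bottom [of a b a'] by (simp add: second_bottom_def)
  obtain a0 a1 where a01: "a0 \<in> first_bottom" "a1 \<in> second_bottom"
    using assms by blast
  have sub: "first_bottom \<subseteq> M" "second_bottom \<subseteq> M"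
    unfolding first_bottom_def second_bottom_def by auto
  have a01': "a0 \<in> M" "a1 \<in> M"
    using a01 sub by auto
  define d where "d = f (a0, a1)"
  \<comment> \<open>From \<open>(a, a')\<close> move along the constant row to the column of
    \<open>a1\<close>, then along that column to \<open>(a0, a1)\<close>; in the other case move
    along the column to the row of \<open>a0\<close> first.\<close>
  have const: "f (a, a') = d"
    if "a \<in> M" "a' \<in> M" "a \<in> first_bottom \<or> a' \<in> second_bottom" for a a'
    using that(3)
  proof
    assume "a \<in> first_bottom"
    then show ?thesis
      using row [of a a'] row [of a a1] col [of a1 a] col [of a1 a0] that(1,2) a01 a01'
      by (simp add: d_def)
  next
    assume "a' \<in> second_bottom"
    then show ?thesis
      using col [of a' a] col [of a' a0] row [of a0 a'] row [of a0 a1] that(1,2) a01 a01'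
      by (simp add: d_def)
  qed
  have "d \<in> M"
    using row [of a0 a1] a01 a01' b by (simp add: d_def first_bottom_def)
  have "M - {d} \<subseteq> f ` ((M - first_bottom) \<times> (M - second_bottom))"
  proof
    fix e assume e: "e \<in> M - {d}"
    then obtain a a' where "a \<in> M" "a' \<in> M" "f (a, a') = e"
      using bottom_onto by blast
    with e const show "e \<in> f ` ((M - first_bottom) \<times> (M - second_bottom))"
      by blast
  qed
  then have "card (M - {d}) \<le> card ((M - first_bottom) \<times> (M - second_bottom))"
    by (meson finite(1) finite_Diff finite_SigmaI surj_card_le)
  then show ?thesis
    using \<open>d \<in> M\<close> sub finite by (simp add: card_cartesian_product card_Diff_subset finite_subset)
qed

text \<open>Distinct elements of \<open>N\<close> are incomparable, so \<open>(x, y)\<close> is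
  comparable to no pair of \<open>N \<times> N\<close>, which leaves only
  \<open>M \<times> K\<close> and \<open>K \<times> M\<close>. For \<open>(x, y)\<close> in
  \<open>M \<times> K\<close> and \<open>c\<close> in \<open>N\<close>, the value
  \<open>f (x, c)\<close> lies below both \<open>f (x, y)\<close> and \<open>f (c, c) = b0\<close>.
  Common lower bounds of two distinct elements of \<open>N\<close> are in \<open>M\<close>, hence
  \<open>x\<close> is in \<open>first_bottom\<close>; dually \<open>y\<close> is in
  \<open>second_top\<close>.\<close>

lemma middle_constant_sources:
  assumes const: "\<forall>b\<in>N. \<forall>b'\<in>N. f (b, b') = b0"
    and x: "x \<in> M \<union> N \<union> K" and y: "y \<in> M \<union> N \<union> K" and val: "f (x, y) \<in> N - {b0}"
  shows "(x, y) \<in> first_bottom \<times> second_top \<union> first_top \<times> second_bottom"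
proof -
  obtain b where b: "b \<in> N" using two_distinct [OF card(2)] by blast
  have b0: "b0 \<in> N" using const middle_in_middle [OF b b] b by simp
  have bottom: "z \<in> M" if "z \<preceq> f (x, y)" "z \<preceq> b0" for z
    using le_middle_bottom [OF that(1)] le_middle_bottom [OF that(2)] val b0 by auto
  have top: "z \<in> K" if "f (x, y) \<preceq> z" "b0 \<preceq> z" for z
    using le_middle_top [OF that(1)] le_middle_top [OF that(2)] val b0 by auto
  have up: False if "x \<preceq> b1" "y \<preceq> b2" "b1 \<in> N" "b2 \<in> N" for b1 b2
    using le_middle [OF mono [OF that(1,2)]] const val b0 that by auto
  have down: False if "b1 \<preceq> x" "b2 \<preceq> y" "b1 \<in> N" "b2 \<in> N" for b1 b2
    using le_middle [OF mono [OF that(1,2)]] const val b0 that by auto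
  have middle: "z \<preceq> z" if "z \<in> N" for z
    using that by (simp add: layered_refl)
  \<comment> \<open>Each of the other seven blocks has a pair of \<open>N \<times> N\<close> above
    or below \<open>(x, y)\<close>: a coordinate already in \<open>N\<close> is kept, any other is
    replaced by \<open>b\<close>.\<close>
  consider "x \<in> M" "y \<in> K" | "x \<in> K" "y \<in> M"
    using x y up [of b b] up [of b y] up [of x b] up [of x y] down [of b b] down [of b y]
      down [of x b] b by (auto simp: middle)
  then show ?thesis
  proof cases
    case 1
    have "f (x, c) \<in> M" if "c \<in> N" for c
      using 1 that const mono_right [of x c y] mono_left [of x c c] by (intro bottom) simp_all
    moreover have "f (c, y) \<in> K" if "c \<in> N" for c
      using 1 that const mono_left [of x c y] mono_right [of c c y] by (intro top) simp_all
    ultimately show ?thesis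
      using 1 unfolding first_bottom_def second_top_def by blast
  next
    case 2
    have "f (c, y) \<in> M" if "c \<in> N" for c
      using 2 that const mono_left [of c x y] mono_right [of c y c] by (intro bottom) simp_all
    moreover have "f (x, c) \<in> K" if "c \<in> N" for c
      using 2 that const mono_right [of x y c] mono_left [of c x c] by (intro top) simp_all
    ultimately show ?thesis
      using 2 unfolding first_top_def second_bottom_def by blast
  qed
qed

text \<open>The summand 1 accounts for \<open>b0\<close>, the only element of \<open>N\<close> that
  needs no source in the two rectangles.\<close>

lemma middle_constant_card:
  assumes const: "\<forall>b\<in>N. \<forall>b'\<in>N. f (b, b') = b0"
  shows "card N \<le> card first_bottom * card second_top + card second_bottom * card first_top + 1"
proof -
  let ?S = "first_bottom \<times> second_top \<union> first_top \<times> second_bottom"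
  have fin: "finite first_bottom" "finite second_bottom" "finite first_top" "finite second_top"
    using finite unfolding first_bottom_def second_bottom_def first_top_def second_top_def by auto
  have "N - {b0} \<subseteq> f ` ?S"
  proof
    fix e assume e: "e \<in> N - {b0}"
    then have "e \<in> f ` ((M \<union> N \<union> K) \<times> (M \<union> N \<union> K))"
      unfolding onto by blast
    then obtain x y where "x \<in> M \<union> N \<union> K" "y \<in> M \<union> N \<union> K" "f (x, y) = e"
      by blast
    then show "e \<in> f ` ?S"
      using middle_constant_sources [OF const] e by blast
  qed
  then have "card (N - {b0}) \<le> card ?S"
    by (meson fin finite_SigmaI finite_UnI surj_card_le)
  also have "\<dots> \<le> card first_bottom * card second_top + card first_top * card second_bottom"
    by (metis card_Un_le card_cartesian_product)
  finally show ?thesis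
    using finite(2) by (simp add: card_Diff_singleton_if mult.commute split: if_splits)
qed

lemma middle_constant_bound:
  assumes const: "\<forall>b\<in>N. \<forall>b'\<in>N. f (b, b') = b0"
  shows "card N \<le> B_bound (card M) (card K) + 1"
proof -
  \<comment> \<open>The pairing is crossed: \<gamma> belongs to \<open>second_top\<close> and
    \<delta> to \<open>first_top\<close>, since the rectangles are
    \<open>first_bottom \<times> second_top\<close> and
    \<open>first_top \<times> second_bottom\<close>.\<close>
  let ?\<alpha> = "card first_bottom" and ?\<beta> = "card second_bottom"
  let ?\<gamma> = "card second_top" and ?\<delta> = "card first_top"
  have le: "?\<alpha> \<le> card M" "?\<beta> \<le> card M" "?\<gamma> \<le> card K" "?\<delta> \<le> card K"
    unfolding first_bottom_def second_bottom_def first_top_def second_top_def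
    by (auto intro!: card_mono finite)
  have "?\<alpha> * ?\<gamma> + ?\<beta> * ?\<delta> \<le> B_bound (card M) (card K)"
  proof (cases "0 < ?\<alpha> \<and> 0 < ?\<beta> \<and> 0 < ?\<gamma> \<and> 0 < ?\<delta>")
    case True
    then have ne: "first_bottom \<noteq> {}" "second_bottom \<noteq> {}" "first_top \<noteq> {}" "second_top \<noteq> {}"
      by auto
    interpret d: layered_surjection K N M f by (rule dual)
    have dsets: "d.first_bottom = first_top" "d.second_bottom = second_top"
      unfolding d.first_bottom_def d.second_bottom_def first_top_def second_top_def by simp_all
    have bot: "card M - 1 \<le> (card M - ?\<alpha>) * (card M - ?\<beta>)"
      using bottom_card_bound ne by blast
    have top: "card K - 1 \<le> (card K - ?\<gamma>) * (card K - ?\<delta>)"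
      using d.bottom_card_bound ne unfolding dsets by (simp add: mult.commute)
    \<comment> \<open>Positive products of truncated differences yield the strict upper bounds on
      \<alpha>, \<beta>, \<gamma>, \<delta> required in \<open>mu_values\<close>.\<close>
    have "0 < (card M - ?\<alpha>) * (card M - ?\<beta>)" "0 < (card K - ?\<gamma>) * (card K - ?\<delta>)"
      using bot top card by linarith+
    then have "?\<alpha> * ?\<gamma> + ?\<beta> * ?\<delta> \<in> mu_values (card M) (card K)"
      using bot top True unfolding mu_values_def by auto
    then show ?thesis
      using Max_ge [OF finite_mu_values, of _ "card M" "card K"] unfolding B_bound_def mu_def
      by (auto simp: le_max_iff_disj)
  next
    case False
    \<comment> \<open>If one of the four counts is zero, one rectangle is empty and the other has at
      most \<open>card M * card K\<close> pairs; this is where the product enters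
      \<open>B_bound\<close>.\<close>
    have "?\<alpha> * ?\<gamma> \<le> card M * card K" "?\<beta> * ?\<delta> \<le> card M * card K"
      using le by (simp_all add: mult_le_mono)
    then have "?\<alpha> * ?\<gamma> + ?\<beta> * ?\<delta> \<le> card M * card K"
      using False by auto
    then show ?thesis unfolding B_bound_def by auto
  qed
  then show ?thesis using middle_constant_card [OF const] by linarith
qed

section \<open>The case where \<open>f\<close> is not constant on the middle block\<close>

text \<open>If some element of \<open>N\<close> has its whole column over \<open>M\<close> sent to \<open>M\<close>, then \<open>f\<close> restricted
  to \<open>M\<close> ignores its second argument; connectedness propagates this to all nine blocks.\<close>

lemma depends_on_first:
  assumes nonconst: "b1 \<in> N" "b2 \<in> N" "b3 \<in> N" "b4 \<in> N" "f (b1, b2) \<noteq> f (b3, b4)"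
    and b0: "b0 \<in> N" and col: "\<forall>a\<in>M. f (a, b0) \<in> M"
    and x: "x \<in> M \<union> N \<union> K" and y: "y \<in> M \<union> N \<union> K"
  shows "f (x, y) = f (x, b0)"
proof -
  interpret d: layered_surjection K N M f by (rule dual)
  have MM: "f (a, a') = f (a, b0)" if "a \<in> M" "a' \<in> M" for a a'
    using that b0 col right_bottom [of a a' b0] by simp
  \<comment> \<open>A value in \<open>M\<close> at \<open>(b, a)\<close> would be shared by all
    \<open>f (a', a)\<close> with \<open>a'\<close> in \<open>M\<close>; as \<open>f\<close> ignores
    its second argument on \<open>M \<times> M\<close>, it would be constant there.\<close>
  have NM: "f (b, a) \<in> N" if "b \<in> N" "a \<in> M" for b a
  proof -
    have "f (b, a) \<notin> M"
    proof
      assume *: "f (b, a) \<in> M"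
      have "f (a', a'') = f (b, a)" if "a' \<in> M" "a'' \<in> M" for a' a''
        using MM [of a' a''] MM [of a' a] left_bottom [of a' b a] * that \<open>b \<in> N\<close> \<open>a \<in> M\<close> by simp
      then show False using bottom_nonconstant [of "f (b, a)"] by blast
    qed
    then show ?thesis
      using le_middle_bottom [OF mono_right [of b a b]] middle_in_middle [of b b] that
      by fastforce
  qed
  obtain a0 where a0: "a0 \<in> M" using two_distinct [OF card(1)] by blast
  obtain c0 where c0: "c0 \<in> K" using two_distinct [OF card(3)] by blast
  have mid: "f (b, b') \<in> N" if "b \<in> N" "b' \<in> N" for b b'
    using that by (rule middle_in_middle)
  have NN: "f (b, a) = f (b, b')" if "b \<in> N" "b' \<in> N" "a \<in> M" for b b' a
    using right_middle [of b a b'] NM mid that by simp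
  have NN': "f (b, b') = f (b, b0)" if "b \<in> N" "b' \<in> N" for b b'
    using NN [of b b0 a0] NN [of b b' a0] that a0 b0 by simp
  have h: "f (b1, b0) \<noteq> f (b3, b0)"
    using nonconst NN' [of b1 b2] NN' [of b3 b4] by simp
  \<comment> \<open>The map sending \<open>b\<close> to \<open>f (b, b0)\<close> takes two distinct
    values in \<open>N\<close> by \<open>h\<close>, so a lower bound of all its values is in
    \<open>M\<close> and an upper bound in \<open>K\<close>.\<close>
  have below: "z \<in> M" if "\<And>b. b \<in> N \<Longrightarrow> z \<preceq> f (b, b0)" for z
    using le_middle_bottom [OF that [OF nonconst(1)] mid] nonconst b0
      le_middle_bottom [OF that [OF nonconst(3)] mid] h by metis
  have above: "z \<in> K" if "\<And>b. b \<in> N \<Longrightarrow> f (b, b0) \<preceq> z" for z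
    using le_middle_top [OF that [OF nonconst(1)] mid] nonconst b0
      le_middle_top [OF that [OF nonconst(3)] mid] h by metis
  have KN: "f (c, b) \<in> K" if "c \<in> K" "b \<in> N" for c b
  proof (rule above)
    fix b' assume "b' \<in> N"
    then show "f (b', b0) \<preceq> f (c, b)"
      using mono_left [of b' c b] NN' [of b' b] that by simp
  qed
  have KK: "f (c, b) = f (c, c')" if "c \<in> K" "c' \<in> K" "b \<in> N" for c c' b
    using that KN right_top [of c b c'] by simp
  have NK: "f (b, c) \<in> N" if "b \<in> N" "c \<in> K" for b c
  proof -
    have "f (b, c) \<notin> K"
    proof
      assume *: "f (b, c) \<in> K"
      have "f (c', c'') = f (b, c)" if "c' \<in> K" "c'' \<in> K" for c' c''
        using KK [of c' c'' b0] KK [of c' c b0] left_top [of b c' c] * that \<open>b \<in> N\<close> \<open>c \<in> K\<close> b0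
        by simp
      then show False using d.bottom_nonconstant [of "f (b, c)"] by blast
    qed
    then show ?thesis
      using le_middle_top [OF mono_right [of b b c]] middle_in_middle [of b b] that
      by fastforce
  qed
  \<comment> \<open>The blocks are now collected by the layer of the first argument. The middle
    layer comes first because it supplies the bounds that place \<open>f (a, y)\<close> in
    \<open>M\<close> and \<open>f (c, y)\<close> in \<open>K\<close>.\<close>
  have NP: "f (b, y) = f (b, b0)" if "b \<in> N" for b
    using y
  proof (elim UnE)
    assume "y \<in> K"
    then show ?thesis
      using right_middle [of b b0 y] NK mid that b0 by simp
  qed (use NN [of b b0 y] NN' [of b y] that b0 in simp_all)
  have MP: "f (a, y) = f (a, b0)" if "a \<in> M" for a
  proof -
    have "f (a, y) \<preceq> f (b, b0)" if "b \<in> N" for b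
      using that mono_left [of a b y] NP y \<open>a \<in> M\<close> by simp
    then have *: "f (a, y) \<in> M" by (rule below)
    show ?thesis
      using y
    proof (elim UnE)
      assume "y \<in> N"
      then show ?thesis
        using MM [OF that a0] right_bottom [of a a0 y] * that a0 by simp
    next
      assume "y \<in> K"
      then show ?thesis
        using right_bottom [of a b0 y] * that b0 by simp
    qed (use MM that in simp)
  qed
  have KP: "f (c, y) = f (c, b0)" if "c \<in> K" for c
  proof -
    have "f (b, b0) \<preceq> f (c, y)" if "b \<in> N" for b
      using that mono_left [of b c y] NP y \<open>c \<in> K\<close> by simp
    then have *: "f (c, y) \<in> K" by (rule above)
    show ?thesis
      using y
    proof (elim UnE)
      assume "y \<in> M"
      then show ?thesis
        using right_top [of c y b0] * that b0 by simp
    next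
      assume "y \<in> N"
      then show ?thesis
        using KK [of c c0 b0] KK [of c c0 y] that b0 c0 by simp
    qed (use KK [of c y b0] that b0 in simp)
  qed
  show ?thesis using x MP NP KP by blast
qed

text \<open>\<open>depends_on_first\<close> applies to \<open>f\<close> or to
  \<open>f \<circ> prod.swap\<close>. Otherwise every \<open>b\<close> in \<open>N\<close> has some
  \<open>a\<close> in \<open>M\<close> with \<open>f (a, b)\<close> outside \<open>M\<close>. This
  value is below every \<open>f (b', b)\<close> in \<open>N\<close>, hence equal to it, so
  \<open>f\<close> is constant in its first argument on \<open>N\<close>. The same holds for the
  second argument, making \<open>f\<close> constant on \<open>N \<times> N\<close>.\<close>

lemma essentially_unary_if_middle_nonconstant:
  assumes nonconst: "b1 \<in> N" "b2 \<in> N" "b3 \<in> N" "b4 \<in> N" "f (b1, b2) \<noteq> f (b3, b4)"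
  shows "essentially_unary (layered M N K) f"
proof -
  interpret s: layered_surjection M N K "f \<circ> prod.swap" by (rule swap)
  have "(\<exists>b\<in>N. \<forall>a\<in>M. f (a, b) \<in> M) \<or> (\<exists>b\<in>N. \<forall>a\<in>M. f (b, a) \<in> M)"
  proof (rule ccontr)
    assume "\<not> ?thesis"
    then have neg: "\<forall>b\<in>N. \<exists>a\<in>M. f (a, b) \<notin> M" "\<forall>b\<in>N. \<exists>a\<in>M. f (b, a) \<notin> M"
      by auto
    have "f (b1, b) = f (b3, b)" if b: "b \<in> N" for b
    proof -
      obtain a where a: "a \<in> M" "f (a, b) \<notin> M" using neg b by blast
      have "f (a, b) = f (b', b)" if "b' \<in> N" for b'
        using le_middle_bottom [OF mono_left [of a b' b]] middle_in_middle [of b' b] a b that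
        by fastforce
      then show ?thesis using nonconst by metis
    qed
    moreover have "f (b1, b2) = f (b1, b4)"
    proof -
      obtain a where a: "a \<in> M" "f (b1, a) \<notin> M" using neg nonconst by blast
      have "f (b1, a) = f (b1, b')" if "b' \<in> N" for b'
        using le_middle_bottom [OF mono_right [of b1 a b']] middle_in_middle [of b1 b'] a
          nonconst that by fastforce
      then show ?thesis using nonconst by metis
    qed
    ultimately show False using nonconst by metis
  qed
  then show ?thesis
  proof (elim disjE bexE)
    fix b assume b: "b \<in> N" "\<forall>a\<in>M. f (a, b) \<in> M"
    have "monotone_map (layered M N K) (layered M N K) (\<lambda>x. f (x, b))"
      unfolding monotone_map_def monotone_on_def Field_layered
      using b closed mono_left by simp
    moreover have "\<forall>x\<in>M \<union> N \<union> K. \<forall>y\<in>M \<union> N \<union> K. f (x, y) = f (x, b)"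
      using depends_on_first [OF nonconst b] by blast
    ultimately show ?thesis
      unfolding essentially_unary_def Field_layered
      by (intro exI [of _ "\<lambda>x. f (x, b)"] conjI disjI1)
  next
    fix b assume b: "b \<in> N" "\<forall>a\<in>M. f (b, a) \<in> M"
    have "monotone_map (layered M N K) (layered M N K) (\<lambda>x. f (b, x))"
      unfolding monotone_map_def monotone_on_def Field_layered
      using b closed mono_right by simp
    moreover have "\<forall>x\<in>M \<union> N \<union> K. \<forall>y\<in>M \<union> N \<union> K. f (x, y) = f (b, y)"
    proof (intro ballI)
      fix x y assume "x \<in> M \<union> N \<union> K" "y \<in> M \<union> N \<union> K"
      then show "f (x, y) = f (b, y)"
        using s.depends_on_first [of b2 b1 b4 b3 b y x] nonconst b by simp
    qed
    ultimately show ?thesis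
      unfolding essentially_unary_def Field_layered
      by (intro exI [of _ "\<lambda>x. f (b, x)"] conjI disjI2)
  qed
qed

end

section \<open>Sufficiency of the bound\<close>

lemma two_slupecki_layered:
  assumes "M \<inter> N = {}" "M \<inter> K = {}" "N \<inter> K = {}" "finite M" "finite N" "finite K"
    and "2 \<le> card M" "2 \<le> card N" "2 \<le> card K"
    and "B_bound (card M) (card K) + 1 < card N"
  shows "two_slupecki (layered M N K)"
  unfolding two_slupecki_def Field_layered
proof (intro allI impI, elim conjE)
  fix f
  assume "binary_polymorphism (layered M N K) f"
    and "f ` ((M \<union> N \<union> K) \<times> (M \<union> N \<union> K)) = M \<union> N \<union> K"
  then interpret layered_surjection M N K f
    using assms by unfold_locales
  obtain b where b: "b \<in> N" using two_distinct [OF card(2)] by blast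
  have "\<not> (\<forall>b'\<in>N. \<forall>b''\<in>N. f (b', b'') = f (b, b))"
    using middle_constant_bound [of "f (b, b)"] assms(10) by linarith
  then obtain b' b'' where "b' \<in> N" "b'' \<in> N" "f (b', b'') \<noteq> f (b, b)"
    by blast
  then show "essentially_unary (layered M N K) f"
    using essentially_unary_if_middle_nonconstant b by blast
qed

section \<open>Polymorphisms showing necessity of the bound\<close>

lemma not_essentially_unaryI:
  assumes "f (x, y) \<noteq> f (x', y)" "f (u, v) \<noteq> f (u, v')"
    and "x \<in> Field r" "x' \<in> Field r" "y \<in> Field r" "u \<in> Field r" "v \<in> Field r" "v' \<in> Field r"
  shows "\<not> essentially_unary r f"
proof
  assume "essentially_unary r f"
  then obtain g where "(\<forall>x\<in>Field r. \<forall>y\<in>Field r. f (x, y) = g x) \<or>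
      (\<forall>x\<in>Field r. \<forall>y\<in>Field r. f (x, y) = g y)"
    unfolding essentially_unary_def by blast
  then show False
    using assms by (elim disjE) simp_all
qed

lemma obtain_surjection:
  assumes "finite X" "Y \<noteq> {}" "card Y \<le> card X" "finite Y"
  obtains h where "h ` X = Y"
proof -
  obtain g where "inj_on g Y" "g ` Y \<subseteq> X"
    using card_le_inj assms by metis
  then show thesis
    using that inj_on_iff_surj [OF assms(2)] by metis
qed

text \<open>Pairs strictly below a pair of \<open>M \<times> K\<close> can be sent to
  \<open>M\<close> by the first projection, and pairs strictly above it to \<open>K\<close> by the
  second. The values on \<open>M \<times> K\<close> may then be arbitrary in \<open>N\<close> and,
  together with \<open>b0\<close>, exhaust it.\<close>

lemma not_two_slupecki_if_le_product:
  fixes M N K :: "'a set"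
  assumes disj: "M \<inter> N = {}" "M \<inter> K = {}" "N \<inter> K = {}" and fin: "finite M" "finite N" "finite K"
    and card: "2 \<le> card M" "2 \<le> card N" "2 \<le> card K"
    and le: "card N \<le> card M * card K + 1"
  shows "\<not> two_slupecki (layered M N K)"
proof -
  let ?P = "M \<union> N \<union> K"
  \<comment> \<open>The second element \<open>b1\<close> makes \<open>N - {b0}\<close> nonempty, as
    \<open>obtain_surjection\<close> demands of its target.\<close>
  obtain b0 b1 where b0: "b0 \<in> N" "b1 \<in> N" "b1 \<noteq> b0"
    using two_distinct card by metis
  obtain a0 a1 where a: "a0 \<in> M" "a1 \<in> M" "a0 \<noteq> a1"
    using two_distinct card by metis
  obtain c0 c1 where c: "c0 \<in> K" "c1 \<in> K" "c0 \<noteq> c1"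
    using two_distinct card by metis
  have "card (N - {b0}) \<le> card (M \<times> K)"
    using le b0 fin by (simp add: card_cartesian_product)
  then obtain h where h: "h ` (M \<times> K) = N - {b0}"
    using obtain_surjection [of "M \<times> K" "N - {b0}"] fin b0 by blast
  have hN: "h (x, y) \<in> N" if "x \<in> M" "y \<in> K" for x y
    using h that by blast
  define f where "f = (\<lambda>(x, y).
    if x \<in> M then (if y \<in> K then h (x, y) else x) else (if y \<in> K then y else b0))"
  have notin: "x \<in> M \<Longrightarrow> x \<notin> K" "x \<in> N \<Longrightarrow> x \<notin> M" "x \<in> N \<Longrightarrow> x \<notin> K" "x \<in> K \<Longrightarrow> x \<notin> M" for x
    using disj by auto
  have f_block:
    "x \<in> M \<Longrightarrow> y \<in> M \<Longrightarrow> f (x, y) = x" "x \<in> M \<Longrightarrow> y \<in> N \<Longrightarrow> f (x, y) = x"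
    "x \<in> M \<Longrightarrow> y \<in> K \<Longrightarrow> f (x, y) = h (x, y)" "x \<in> N \<Longrightarrow> y \<in> M \<Longrightarrow> f (x, y) = b0"
    "x \<in> N \<Longrightarrow> y \<in> N \<Longrightarrow> f (x, y) = b0" "x \<in> N \<Longrightarrow> y \<in> K \<Longrightarrow> f (x, y) = y"
    "x \<in> K \<Longrightarrow> y \<in> M \<Longrightarrow> f (x, y) = b0" "x \<in> K \<Longrightarrow> y \<in> N \<Longrightarrow> f (x, y) = b0"
    "x \<in> K \<Longrightarrow> y \<in> K \<Longrightarrow> f (x, y) = y" for x y
    by (simp_all add: f_def notin)
  have closed: "f (x, y) \<in> ?P" if "x \<in> ?P" "y \<in> ?P" for x y
    using that b0 hN by (elim UnE) (simp_all add: f_block)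
  have "binary_polymorphism (layered M N K) f"
    unfolding binary_polymorphism_layered
  proof (intro conjI allI impI)
    show "f \<in> ?P \<times> ?P \<rightarrow> ?P" using closed by blast
    fix x x' y y' assume "(x, x') \<in> layered M N K" "(y, y') \<in> layered M N K"
    then show "(f (x, y), f (x', y')) \<in> layered M N K"
      by (elim layered_cases; simp add: f_block b0 hN layered_refl layered_less)
  qed
  moreover have "f ` (?P \<times> ?P) = ?P"
  proof
    show "f ` (?P \<times> ?P) \<subseteq> ?P"
      using closed by blast
    define I where "I = f ` (?P \<times> ?P)"
    have hit: "z \<in> I" if "f (x, y) = z" "x \<in> ?P" "y \<in> ?P" for x y z
      using that unfolding I_def by blast
    have "x \<in> I" if "x \<in> M" for x
      using that by (intro hit [of x x]) (simp_all add: f_block)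
    moreover have "x \<in> I" if "x \<in> K" for x
      using that by (intro hit [of x x]) (simp_all add: f_block)
    moreover have "b0 \<in> I"
      using b0 by (intro hit [of b0 b0]) (simp_all add: f_block)
    moreover have "x \<in> I" if x: "x \<in> N - {b0}" for x
    proof -
      obtain p q where "p \<in> M" "q \<in> K" "x = h (p, q)"
        using x [folded h] by blast
      then show ?thesis
        by (intro hit [of p q]) (simp_all add: f_block)
    qed
    ultimately have "?P \<subseteq> I" by blast
    then show "?P \<subseteq> f ` (?P \<times> ?P)" unfolding I_def .
  qed
  moreover have "\<not> essentially_unary (layered M N K) f"
  proof -
    have "f (a0, b0) \<noteq> f (a1, b0)" "f (b0, c0) \<noteq> f (b0, c1)"
      using a b0 c by (simp_all add: f_block)
    then show ?thesis
      by (rule not_essentially_unaryI) (use a b0 c in \<open>simp_all add: Field_layered\<close>)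
  qed
  ultimately show ?thesis
    unfolding two_slupecki_def Field_layered by blast
qed

text \<open>The counting argument is reversed: \<open>A\<close>, \<open>B\<close>, \<open>C\<close>,
  \<open>D\<close> take the roles of \<open>first_bottom\<close>, \<open>second_bottom\<close>,
  \<open>second_top\<close>, \<open>first_top\<close>. The maps \<open>p\<close>, \<open>q\<close>
  and \<open>h\<close> cover each layer up to one element, and \<open>a0\<close>, \<open>c0\<close>
  and \<open>b0\<close> fill the remaining places.\<close>

lemma not_two_slupecki_if_le_mu_value:
  fixes M N K :: "'a set"
  assumes disj: "M \<inter> N = {}" "M \<inter> K = {}" "N \<inter> K = {}" and fin: "finite M" "finite N" "finite K"
    and card: "2 \<le> card M" "2 \<le> card N" "2 \<le> card K"
    and v: "v \<in> mu_values (card M) (card K)" and le: "card N \<le> v + 1"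
  shows "\<not> two_slupecki (layered M N K)"
proof -
  let ?P = "M \<union> N \<union> K"
  obtain \<alpha> \<beta> \<gamma> \<delta> where v_eq: "v = \<alpha> * \<gamma> + \<beta> * \<delta>"
    and pos: "0 < \<alpha>" "0 < \<beta>" "0 < \<gamma>" "0 < \<delta>"
    and lt: "\<alpha> < card M" "\<beta> < card M" "\<gamma> < card K" "\<delta> < card K"
    and bot: "card M - 1 \<le> (card M - \<alpha>) * (card M - \<beta>)"
    and top: "card K - 1 \<le> (card K - \<gamma>) * (card K - \<delta>)"
    using v unfolding mu_values_def by blast
  obtain A where A: "A \<subseteq> M" "card A = \<alpha>"
    using obtain_subset_with_card_n lt by (metis less_imp_le)
  obtain B where B: "B \<subseteq> M" "card B = \<beta>"
    using obtain_subset_with_card_n lt by (metis less_imp_le)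
  obtain C where C: "C \<subseteq> K" "card C = \<gamma>"
    using obtain_subset_with_card_n lt by (metis less_imp_le)
  obtain D where D: "D \<subseteq> K" "card D = \<delta>"
    using obtain_subset_with_card_n lt by (metis less_imp_le)
  have finABCD: "finite A" "finite B" "finite C" "finite D"
    using A B C D fin finite_subset by blast+
  \<comment> \<open>The strict bounds on \<alpha> and \<beta> make the complements nonempty;
    \<open>a\<close>, \<open>a'\<close> and \<open>b\<close>, \<open>b'\<close> later show that
    \<open>f\<close> depends on each argument.\<close>
  obtain a a' b b' where ab: "a \<in> A" "a' \<in> M - A" "b \<in> B" "b' \<in> M - B"
  proof -
    have "A \<noteq> {}" "B \<noteq> {}" "M - A \<noteq> {}" "M - B \<noteq> {}"
      using A B pos lt by auto
    with that show thesis by blast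
  qed
  obtain a0 a1 where a0: "a0 \<in> M" "a1 \<in> M" "a1 \<noteq> a0"
    using two_distinct card by metis
  obtain b0 b1 where b0: "b0 \<in> N" "b1 \<in> N" "b1 \<noteq> b0"
    using two_distinct card by metis
  obtain c0 c1 where c0: "c0 \<in> K" "c1 \<in> K" "c1 \<noteq> c0"
    using two_distinct card by metis
  have "card (M - {a0}) \<le> card ((M - A) \<times> (M - B))"
    using bot A B a0 fin finABCD by (simp add: card_cartesian_product card_Diff_subset)
  then obtain p where p: "p ` ((M - A) \<times> (M - B)) = M - {a0}"
    using obtain_surjection [of "(M - A) \<times> (M - B)" "M - {a0}"] fin a0 by blast
  \<comment> \<open>\<open>D\<close> constrains the first coordinate and \<open>C\<close> the
    second, so the factors appear in the opposite order to \<gamma>, \<delta>.\<close>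
  have "card (K - {c0}) \<le> card ((K - D) \<times> (K - C))"
    using top C D c0 fin finABCD
    by (simp add: card_cartesian_product card_Diff_subset mult.commute)
  then obtain q where q: "q ` ((K - D) \<times> (K - C)) = K - {c0}"
    using obtain_surjection [of "(K - D) \<times> (K - C)" "K - {c0}"] fin c0 by blast
  \<comment> \<open>The rectangles are disjoint because \<open>A\<close> lies in \<open>M\<close>
    and \<open>D\<close> in \<open>K\<close>.\<close>
  have "card (A \<times> C \<union> D \<times> B) = v"
    using A B C D disj finABCD unfolding v_eq
    by (subst card_Un_disjoint) (auto simp: card_cartesian_product mult.commute)
  then have "card (N - {b0}) \<le> card (A \<times> C \<union> D \<times> B)"
    using le b0 fin by simp
  then obtain h where h: "h ` (A \<times> C \<union> D \<times> B) = N - {b0}"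
    using obtain_surjection [of "A \<times> C \<union> D \<times> B" "N - {b0}"] fin b0 finABCD by blast
  have pM: "p (x, y) \<in> M" if "x \<in> M - A" "y \<in> M - B" for x y
    using p that by blast
  have qK: "q (x, y) \<in> K" if "x \<in> K - D" "y \<in> K - C" for x y
    using q that by blast
  have hN: "h (x, y) \<in> N" if "x \<in> A \<and> y \<in> C \<or> x \<in> D \<and> y \<in> B" for x y
    using h that by blast
  define f where "f = (\<lambda>(x, y).
    if x \<in> M then
      if y \<in> M then (if x \<in> A \<or> y \<in> B then a0 else p (x, y))
      else if y \<in> N then (if x \<in> A then a0 else b0)
      else (if x \<in> A \<and> y \<in> C then h (x, y) else b0)
    else if x \<in> N then
      if y \<in> M then (if y \<in> B then a0 else b0)
      else if y \<in> N then b0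
      else (if y \<in> C then c0 else b0)
    else
      if y \<in> M then (if x \<in> D \<and> y \<in> B then h (x, y) else b0)
      else if y \<in> N then (if x \<in> D then c0 else b0)
      else (if x \<in> D \<or> y \<in> C then c0 else q (x, y)))"
  have notin: "x \<in> N \<Longrightarrow> x \<notin> M" "x \<in> K \<Longrightarrow> x \<notin> M" "x \<in> K \<Longrightarrow> x \<notin> N" for x
    using disj by auto
  have sub: "x \<in> A \<Longrightarrow> x \<in> M" "x \<in> B \<Longrightarrow> x \<in> M" "x \<in> C \<Longrightarrow> x \<in> K" "x \<in> D \<Longrightarrow> x \<in> K" for x
    using A B C D by auto
  have f_block:
    "x \<in> M \<Longrightarrow> y \<in> M \<Longrightarrow> f (x, y) = (if x \<in> A \<or> y \<in> B then a0 else p (x, y))"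
    "x \<in> M \<Longrightarrow> y \<in> N \<Longrightarrow> f (x, y) = (if x \<in> A then a0 else b0)"
    "x \<in> M \<Longrightarrow> y \<in> K \<Longrightarrow> f (x, y) = (if x \<in> A \<and> y \<in> C then h (x, y) else b0)"
    "x \<in> N \<Longrightarrow> y \<in> M \<Longrightarrow> f (x, y) = (if y \<in> B then a0 else b0)"
    "x \<in> N \<Longrightarrow> y \<in> N \<Longrightarrow> f (x, y) = b0"
    "x \<in> N \<Longrightarrow> y \<in> K \<Longrightarrow> f (x, y) = (if y \<in> C then c0 else b0)"
    "x \<in> K \<Longrightarrow> y \<in> M \<Longrightarrow> f (x, y) = (if x \<in> D \<and> y \<in> B then h (x, y) else b0)"
    "x \<in> K \<Longrightarrow> y \<in> N \<Longrightarrow> f (x, y) = (if x \<in> D then c0 else b0)"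
    "x \<in> K \<Longrightarrow> y \<in> K \<Longrightarrow> f (x, y) = (if x \<in> D \<or> y \<in> C then c0 else q (x, y))" for x y
    by (simp_all add: f_def notin)
  have closed: "f (x, y) \<in> ?P" if "x \<in> ?P" "y \<in> ?P" for x y
    using that a0 b0 c0 pM qK hN by (elim UnE) (simp_all add: f_block)
  have "binary_polymorphism (layered M N K) f"
    unfolding binary_polymorphism_layered
  proof (intro conjI allI impI)
    show "f \<in> ?P \<times> ?P \<rightarrow> ?P" using closed by blast
    fix x x' y y' assume "(x, x') \<in> layered M N K" "(y, y') \<in> layered M N K"
    then show "(f (x, y), f (x', y')) \<in> layered M N K"
      by (elim layered_cases; simp add: f_block a0 b0 c0 pM qK hN layered_refl layered_less)
  qed
  moreover have "f ` (?P \<times> ?P) = ?P"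
  proof
    show "f ` (?P \<times> ?P) \<subseteq> ?P"
      using closed by blast
    define I where "I = f ` (?P \<times> ?P)"
    have hit: "z \<in> I" if "f (x, y) = z" "x \<in> ?P" "y \<in> ?P" for x y z
      using that unfolding I_def by blast
    have "a0 \<in> I"
      using ab sub b0 by (intro hit [of a b0]) (simp_all add: f_block)
    moreover have "x \<in> I" if x: "x \<in> M - {a0}" for x
    proof -
      obtain y z where "y \<in> M - A" "z \<in> M - B" "x = p (y, z)"
        using x [folded p] by blast
      then show ?thesis
        by (intro hit [of y z]) (auto simp: f_block sub)
    qed
    moreover have "b0 \<in> I"
      using b0 by (intro hit [of b0 b0]) (simp_all add: f_block)
    moreover have "x \<in> I" if x: "x \<in> N - {b0}" for x
    proof -
      obtain y z where "y \<in> A \<and> z \<in> C \<or> y \<in> D \<and> z \<in> B" "x = h (y, z)"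
        using x [folded h] by blast
      then show ?thesis
        by (intro hit [of y z]) (auto simp: f_block sub)
    qed
    moreover have "c0 \<in> I"
    proof -
      have "C \<noteq> {}" using C pos by auto
      then obtain c where "c \<in> C" by blast
      then show ?thesis
        using b0 sub by (intro hit [of b0 c]) (simp_all add: f_block)
    qed
    moreover have "x \<in> I" if x: "x \<in> K - {c0}" for x
    proof -
      obtain y z where "y \<in> K - D" "z \<in> K - C" "x = q (y, z)"
        using x [folded q] by blast
      then show ?thesis
        by (intro hit [of y z]) (auto simp: f_block sub)
    qed
    ultimately have "?P \<subseteq> I" by blast
    then show "?P \<subseteq> f ` (?P \<times> ?P)" unfolding I_def .
  qed
  moreover have "\<not> essentially_unary (layered M N K) f"
  proof -
    have "f (a, b0) = a0" "f (b0, b) = a0" "f (a', b0) = b0" "f (b0, b') = b0"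
      using ab b0 sub by (simp_all add: f_block)
    then have "f (a, b0) \<noteq> f (a', b0)" "f (b0, b) \<noteq> f (b0, b')"
      using a0 b0 notin by auto
    then show ?thesis
      by (rule not_essentially_unaryI) (use ab b0 sub in \<open>simp_all add: Field_layered\<close>)
  qed
  ultimately show ?thesis
    unfolding two_slupecki_def Field_layered by blast
qed

section \<open>Transfer to ordinal sums of antichains\<close>

lemma ordinal_sum_iff:
  "(Inl x, Inl x') \<in> r \<oplus> s \<longleftrightarrow> (x, x') \<in> r"
  "(Inr y, Inr y') \<in> r \<oplus> s \<longleftrightarrow> (y, y') \<in> s"
  "(Inl x, Inr y) \<in> r \<oplus> s \<longleftrightarrow> x \<in> Field r \<and> y \<in> Field s"
  "(Inr y, Inl x) \<notin> r \<oplus> s"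
  by (auto simp: ordinal_sum_def)

lemma antichain_sum_layered:
  "antichain m \<oplus> antichain n \<oplus> antichain k =
     layered (Inl ` Inl ` {..<m}) (Inl ` Inr ` {..<n}) (Inr ` {..<k})"
  (is "?r = ?s")
proof -
  have exhaust: "(\<exists>a. z = Inl (Inl a)) \<or> (\<exists>b. z = Inl (Inr b)) \<or> (\<exists>c. z = Inr c)"
    for z :: "(nat + nat) + nat"
  proof (cases z)
    case (Inl w)
    then show ?thesis by (cases w) auto
  qed auto
  have antichain_iff: "(i, j) \<in> antichain l \<longleftrightarrow> i = j \<and> i < l" for i j l
    by (auto simp: antichain_def)
  have layered_iff: "(x, y) \<in> layered M N K \<longleftrightarrow>
      x = y \<and> (x \<in> M \<or> x \<in> N \<or> x \<in> K) \<or> x \<in> M \<and> (y \<in> N \<or> y \<in> K) \<or> x \<in> N \<and> y \<in> K"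
    for x y and M N K :: "((nat + nat) + nat) set"
    unfolding layered_def by blast
  have image_iffs:
    "Inl (Inl i) \<in> (Inl ` Inl ` {..<l} :: ((nat + nat) + nat) set) \<longleftrightarrow> i < l"
    "Inl (Inr i) \<in> (Inl ` Inr ` {..<l} :: ((nat + nat) + nat) set) \<longleftrightarrow> i < l"
    "Inr i \<in> (Inr ` {..<l} :: ((nat + nat) + nat) set) \<longleftrightarrow> i < l"
    "Inl (Inr i) \<notin> (Inl ` Inl ` {..<l} :: ((nat + nat) + nat) set)"
    "Inl (Inl i) \<notin> (Inl ` Inr ` {..<l} :: ((nat + nat) + nat) set)"
    "Inr i \<notin> (Inl ` S :: ((nat + nat) + nat) set)" "Inl w \<notin> (Inr ` {..<l} :: ((nat + nat) + nat) set)"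
    for i l w S
    by auto
  have "(x, y) \<in> ?r \<longleftrightarrow> (x, y) \<in> ?s" for x y
    using exhaust [of x] exhaust [of y]
    by (elim disjE exE; hypsubst)
      (auto simp: ordinal_sum_iff Field_ordinal_sum Field_antichain antichain_iff layered_iff
        image_iffs)
  then show ?thesis by (intro set_eqI) (simp add: split_paired_all)
qed

theorem theorem5p5:
  fixes m n k :: nat
  assumes "m \<ge> 2" and "n \<ge> 2" and "k \<ge> 2"
  shows "two_slupecki (antichain m \<oplus> antichain n \<oplus> antichain k) \<longleftrightarrow> n > B_bound m k + 1"
proof -
  define M :: "((nat + nat) + nat) set" where "M = Inl ` Inl ` {..<m}"
  define N :: "((nat + nat) + nat) set" where "N = Inl ` Inr ` {..<n}"
  define K :: "((nat + nat) + nat) set" where "K = Inr ` {..<k}"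
  have sum: "antichain m \<oplus> antichain n \<oplus> antichain k = layered M N K"
    unfolding M_def N_def K_def by (rule antichain_sum_layered)
  have disj: "M \<inter> N = {}" "M \<inter> K = {}" "N \<inter> K = {}" and fin: "finite M" "finite N" "finite K"
    unfolding M_def N_def K_def by auto
  have card_eq: "card M = m" "card N = n" "card K = k"
    unfolding M_def N_def K_def by (auto simp: card_image inj_on_def)
  have card: "2 \<le> card M" "2 \<le> card N" "2 \<le> card K"
    using assms card_eq by auto
  show ?thesis
  proof
    assume "B_bound m k + 1 < n"
    then show "two_slupecki (antichain m \<oplus> antichain n \<oplus> antichain k)"
      unfolding sum using two_slupecki_layered [OF disj fin card] card_eq by simp
  next
    assume sl: "two_slupecki (antichain m \<oplus> antichain n \<oplus> antichain k)"
    have "m * k + 1 < n"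
      using not_two_slupecki_if_le_product [OF disj fin card] sl card_eq unfolding sum
      by (meson not_le)
    \<comment> \<open>A nonempty finite set attains its maximum, so the second construction applies
      to \<open>mu m k\<close> itself; when the set is empty, \<open>B_bound\<close> is just the
      product.\<close>
    moreover have "mu m k + 1 < n" if "mu_values m k \<noteq> {}"
      using not_two_slupecki_if_le_mu_value [OF disj fin card, of "mu m k"] sl card_eq that
        Max_in [OF finite_mu_values that] unfolding sum mu_def by (metis not_le)
    ultimately show "B_bound m k + 1 < n"
      by (auto simp: B_bound_def max_def)
  qed
qed

end
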